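(* Let $\mathcal{I}$ be a thinnable ideal on $\mathbf{N}$ and let $x=(x_n)_{n\in\mathbf{N}}$ be a sequence taking values in a first countable topological space $X$ in which every closed subset is separable. Then $$ \lambda\left(\left\{\omega \in (0,1]: \Gamma_x(\mathcal{I})=\Gamma_{x\upharpoonright \omega}(\mathcal{I})\right\}\right)=1. $$
   Context: $\mathbf{N}$ denotes the set of positive integers. An ideal $\mathcal{I}$ on $\mathbf{N}$ is a family of subsets of $\mathbf{N}$ closed under finite unions and under taking subsets of its elements; it is always assumed that $\mathcal{I}$ contains the collection $\mathrm{Fin}$ of all finite subsets of $\mathbf{N}$ and that $\mathcal{I}$ is different from the whole power set of $\mathbf{N}$. For infinite sets $A,B\subseteq\mathbf{N}$ with canonical (increasing) enumerations $\{a_n:n\in\mathbf{N}\}$ and $\{b_n:n\in\mathbf{N}\}$, write $A\le B$ if $a_n\le b_n$ for all $n\in\mathbf{N}$, and define $A_B:=\{a_b:b\in B\}$. A set $A\subseteq\mathbf{N}$ admits non-zero asymptotic density if the limit $\lim_{n\to\infty}|A\cap[1,n]|/n$ exists and is positive. An ideal $\mathcal{I}$ is weakly thinnable if $A_B\notin\mathcal{I}$ whenever $A\subseteq\mathbf{N}$ admits non-zero asymptotic density and $B\notin\mathcal{I}$. An ideal $\mathcal{I}$ is thinnable if it is weakly thinnable and, in addition: (i) $B_A\notin\mathcal{I}$ whenever $A\subseteq\mathbf{N}$ admits non-zero asymptotic density and $B\notin\mathcal{I}$; and (ii) $X\notin\mathcal{I}$ whenever $X,Y\subseteq\mathbf{N}$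 are infinite sets with $X\le Y$ and $Y\notin\mathcal{I}$. For a sequence $x=(x_n)$ in a topological space $X$, $\Gamma_x(\mathcal{I})$ denotes the set of $\mathcal{I}$-cluster points of $x$, i.e., the set of all $\ell\in X$ such that $\{n\in\mathbf{N}:x_n\in U\}\notin\mathcal{I}$ for every neighborhood $U$ of $\ell$. Each $\omega\in(0,1]$ has a unique non-terminating dyadic expansion $\omega=\sum_{i\ge1}d_i(\omega)2^{-i}$ with $d_i(\omega)\in\{0,1\}$ and $d_i(\omega)=1$ for infinitely many $i$. The sequence $x\upharpoonright\omega$ is the subsequence of $(x_n)$ obtained by omitting $x_i$ if and only if $d_i(\omega)=0$ (reindexed by $\mathbf{N}$ in increasing order of the remaining indices). $\lambda$ denotes the Lebesgue measure on the completion of the Borel $\sigma$-algebra of $(0,1]$; the statement that $\lambda$ of a set equals $1$ includes that the set is measurable with respect to this completed $\sigma$-algebra. *)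

theory Defs
  imports "HOL-Analysis.Analysis"
begin

text \<open>
  The positive integers are represented by the set \<open>{1..}\<close> of type \<^typ>\<open>nat set\<close>. Sequences
  indexed by the positive integers are functions on \<^typ>\<open>nat\<close> whose value at \<open>0\<close> is ignored.
\<close>

definition ideal_on_pos :: "nat set set \<Rightarrow> bool" where
  "ideal_on_pos I \<longleftrightarrow>
     I \<subseteq> Pow {1..} \<and>
     (\<forall>A\<in>I. \<forall>B\<in>I. A \<union> B \<in> I) \<and>
     (\<forall>A\<in>I. \<forall>B. B \<subseteq> A \<longrightarrow> B \<in> I) \<and>
     (\<forall>A. A \<subseteq> {1..} \<and> finite A \<longrightarrow> A \<in> I) \<and>
     I \<noteq> Pow {1..}"

text \<open>
  The library function \<^const>\<open>enumerate\<close> counts from \<open>0\<close>, so the \<open>n\<close>-th element of an infinite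
  set, counting from \<open>1\<close>, is obtained by a shift. It is meaningful only for \<open>n \<ge> 1\<close>.
\<close>

definition nth_elem :: "nat set \<Rightarrow> nat \<Rightarrow> nat" where
  "nth_elem A n = enumerate A (n - 1)"

definition enum_le :: "nat set \<Rightarrow> nat set \<Rightarrow> bool" where
  "enum_le A B \<longleftrightarrow> (\<forall>n\<ge>1. nth_elem A n \<le> nth_elem B n)"

text \<open>The set \<open>A\<^sub>B = {a\<^sub>b : b \<in> B}\<close>, for infinite \<open>A\<close> and \<open>B\<close>.\<close>

definition thin :: "nat set \<Rightarrow> nat set \<Rightarrow> nat set" where
  "thin A B = nth_elem A ` B"

definition nonzero_density :: "nat set \<Rightarrow> bool" where
  "nonzero_density A \<longleftrightarrow>
     (\<exists>d>0. (\<lambda>n. real (card (A \<inter> {1..n})) / real n) \<longlonglongrightarrow> d)"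

text \<open>
  In the next two definitions the sets \<open>A\<close> and \<open>B\<close> are automatically infinite: a set of non-zero
  density is infinite, and an ideal contains all finite sets.
\<close>

definition weakly_thinnable :: "nat set set \<Rightarrow> bool" where
  "weakly_thinnable I \<longleftrightarrow> ideal_on_pos I \<and>
     (\<forall>A B. A \<subseteq> {1..} \<and> B \<subseteq> {1..} \<and> nonzero_density A \<and> B \<notin> I \<longrightarrow> thin A B \<notin> I)"

definition thinnable :: "nat set set \<Rightarrow> bool" where
  "thinnable I \<longleftrightarrow> weakly_thinnable I \<and>
     (\<forall>A B. A \<subseteq> {1..} \<and> B \<subseteq> {1..} \<and> nonzero_density A \<and> B \<notin> I \<longrightarrow> thin B A \<notin> I) \<and>
     (\<forall>X Y. X \<subseteq> {1..} \<and> Y \<subseteq> {1..} \<and> infinite X \<and> infinite Y \<and> enum_le X Y \<and> Y \<notin> I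
        \<longrightarrow> X \<notin> I)"

definition ideal_cluster_points ::
    "'a topology \<Rightarrow> nat set set \<Rightarrow> (nat \<Rightarrow> 'a) \<Rightarrow> 'a set" where
  "ideal_cluster_points X I x =
     {l \<in> topspace X. \<forall>U \<subseteq> topspace X.
        (\<exists>V. openin X V \<and> l \<in> V \<and> V \<subseteq> U) \<longrightarrow> {n. 1 \<le> n \<and> x n \<in> U} \<notin> I}"

text \<open>
  Digits are indexed from \<open>1\<close>; the value at \<open>0\<close> is fixed only to make the digit function unique.
\<close>

definition nonterminating_dyadic :: "real \<Rightarrow> (nat \<Rightarrow> nat) \<Rightarrow> bool" where
  "nonterminating_dyadic w d \<longleftrightarrow>
     d 0 = 0 \<and> (\<forall>i. d i \<in> {0, 1}) \<and> infinite {i. d i = 1} \<and>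
     (\<lambda>i. real (d (Suc i)) / 2 ^ Suc i) sums w"

definition dyadic_digit :: "real \<Rightarrow> nat \<Rightarrow> nat" where
  "dyadic_digit w = (THE d. nonterminating_dyadic w d)"

definition subseq_along :: "(nat \<Rightarrow> 'a) \<Rightarrow> real \<Rightarrow> nat \<Rightarrow> 'a" where
  "subseq_along x w n = x (nth_elem {i. 1 \<le> i \<and> dyadic_digit w i = 1} n)"

definition unit_lebesgue :: "real measure" where
  "unit_lebesgue = completion (restrict_space lborel {0<..1})"

text \<open>The definite description in \<^const>\<open>dyadic_digit\<close> is justified.\<close>

lemma nonterminating_dyadic_tail:
  assumes "nonterminating_dyadic w d"
  shows "2 ^ n * (w - (\<Sum>i<n. real (d (Suc i)) / 2 ^ Suc i)) \<in> {0<..1}"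
proof -
  let ?f = "\<lambda>i. real (d (Suc i)) / 2 ^ Suc i"
  have d: "d i \<in> {0, 1}" for i
    using assms by (auto simp: nonterminating_dyadic_def)
  have inf: "infinite {i. d i = 1}" and s: "?f sums w"
    using assms by (auto simp: nonterminating_dyadic_def)
  have t: "(\<lambda>i. ?f (i + n)) sums (w - (\<Sum>i<n. ?f i))"
    using s by (rule sums_split_initial_segment)
  have g: "(\<lambda>i. (1/2::real) ^ (i + n + 1)) sums (1 / 2 ^ n)"
    using sums_mult[OF power_half_series, of "1/2 ^ n"]
    by (simp add: power_add power_one_over field_simps)
  have "?f (i + n) \<le> (1/2) ^ (i + n + 1)" for i
    using d[of "Suc (i + n)"] by (auto simp: power_one_over)
  then have le: "w - (\<Sum>i<n. ?f i) \<le> 1 / 2 ^ n"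
    using sums_le[OF _ t g] by blast
  obtain m where m: "m > n" "d m = 1"
    using inf unfolding infinite_nat_iff_unbounded by auto
  define k where "k = m - Suc n"
  have k: "m = Suc (k + n)" using m by (simp add: k_def)
  have "0 < ?f (k + n)" using m k by simp
  then have "0 < (\<Sum>i. ?f (i + n))"
    using suminf_pos2[OF sums_summable[OF t], of k] by simp
  then have "0 < w - (\<Sum>i<n. ?f i)"
    using sums_unique[OF t] by simp
  with le show ?thesis by (simp add: field_simps)
qed

lemma ex1_nonterminating_dyadic:
  assumes w: "w \<in> {0<..1}"
  shows "\<exists>!d. nonterminating_dyadic w d"
proof (rule ex_ex1I)
  define c where "c n = \<lceil>2 ^ n * w\<rceil> - 1" for n
  define d where "d n = (if n = 0 then 0 else nat (c n - 2 * c (n - 1)))" for n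
  have c: "real_of_int (c n) < 2 ^ n * w" "2 ^ n * w \<le> real_of_int (c n) + 1" for n
    unfolding c_def by linarith+
  have step: "c (Suc n) - 2 * c n \<in> {0, 1}" for n
  proof -
    have "real_of_int (2 * c n) < real_of_int (c (Suc n) + 1)"
      "real_of_int (c (Suc n)) < real_of_int (2 * c n + 2)"
      using c[of n] c[of "Suc n"] by (auto simp: mult.assoc)
    then show ?thesis by auto
  qed
  have c0: "c 0 = 0" using w by (simp add: c_def ceiling_eq_iff)
  have d01: "d n \<in> {0, 1}" for n
    using step[of "n - 1"] by (cases n) (auto simp: d_def)
  have dS: "real (d (Suc n)) = real_of_int (c (Suc n)) - 2 * real_of_int (c n)" for n
    using step[of n] by (auto simp: d_def)
  have part: "(\<Sum>i<n. real (d (Suc i)) / 2 ^ Suc i) = real_of_int (c n) / 2 ^ n" for n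
    by (induction n) (simp_all add: c0 dS field_simps)
  have "(\<lambda>n. real_of_int (c n) / 2 ^ n) \<longlonglongrightarrow> w"
  proof (rule tendsto_sandwich)
    show "(\<lambda>n. w - (1/2) ^ n) \<longlonglongrightarrow> w"
      using tendsto_diff[OF tendsto_const LIMSEQ_power_zero[of "1/2::real"], of w] by simp
    show "\<forall>\<^sub>F n in sequentially. w - (1/2) ^ n \<le> real_of_int (c n) / 2 ^ n"
    proof (rule always_eventually, rule allI)
      fix n
      have "w \<le> (real_of_int (c n) + 1) / 2 ^ n"
        using c(2)[of n] by (simp add: pos_le_divide_eq mult.commute)
      then show "w - (1/2) ^ n \<le> real_of_int (c n) / 2 ^ n"
        by (simp add: power_one_over add_divide_distrib)
    qed
    show "\<forall>\<^sub>F n in sequentially. real_of_int (c n) / 2 ^ n \<le> w"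
    proof (rule always_eventually, rule allI)
      fix n
      show "real_of_int (c n) / 2 ^ n \<le> w"
        using c(1)[of n] by (simp add: field_simps)
    qed
  qed simp
  then have s: "(\<lambda>i. real (d (Suc i)) / 2 ^ Suc i) sums w"
    unfolding sums_def part .
  have "infinite {i. d i = 1}"
  proof
    assume "finite {i. d i = 1}"
    then obtain N where N: "\<And>i. d i = 1 \<Longrightarrow> i < N"
      unfolding finite_nat_set_iff_bounded by auto
    have "real (d (Suc i)) / 2 ^ Suc i = 0" if "i \<notin> {..<N}" for i
      using N[of "Suc i"] d01[of "Suc i"] that by auto
    then have "w = (\<Sum>i<N. real (d (Suc i)) / 2 ^ Suc i)"
      using sums_unique2[OF s sums_finite[of "{..<N}"]] by auto
    also have "\<dots> = real_of_int (c N) / 2 ^ N" by (rule part)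
    finally show False using c(1)[of N] by (simp add: field_simps)
  qed
  then have "nonterminating_dyadic w d"
    using d01 s by (auto simp: nonterminating_dyadic_def d_def)
  then show "\<exists>d. nonterminating_dyadic w d" by blast
next
  fix d e assume D: "nonterminating_dyadic w d" and E: "nonterminating_dyadic w e"
  have "d n = e n" for n
  proof (induction n rule: less_induct)
    case (less n)
    show ?case
    proof (cases n)
      case 0
      then show ?thesis using D E by (simp add: nonterminating_dyadic_def)
    next
      case (Suc m)
      define p where "p = (\<Sum>i<m. real (d (Suc i)) / 2 ^ Suc i)"
      have p: "p = (\<Sum>i<m. real (e (Suc i)) / 2 ^ Suc i)"
        unfolding p_def using less Suc by (intro sum.cong) auto
      have sd: "(\<Sum>i<Suc m. real (d (Suc i)) / 2 ^ Suc i) = p + real (d n) / 2 ^ Suc m"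
        by (simp add: p_def Suc)
      have td: "2 ^ Suc m * (w - p) - real (d n) \<in> {0<..1}"
        using nonterminating_dyadic_tail[OF D, of "Suc m"] unfolding sd
        by (simp add: algebra_simps)
      have se: "(\<Sum>i<Suc m. real (e (Suc i)) / 2 ^ Suc i) = p + real (e n) / 2 ^ Suc m"
        by (simp add: p Suc)
      have te: "2 ^ Suc m * (w - p) - real (e n) \<in> {0<..1}"
        using nonterminating_dyadic_tail[OF E, of "Suc m"] unfolding se
        by (simp add: algebra_simps)
      have "\<bar>real (d n) - real (e n)\<bar> < 1" using td te by auto
      then show ?thesis by linarith
    qed
  qed
  then show "d = e" by blast
qed

end

theory Submission
  imports Defs "HOL-Library.Discrete_Functions"
begin

text \<open>
  Fix \<open>w\<close>, let \<open>S\<close> be the set of positions of the digit \<open>1\<close> in \<open>w\<close>, and let \<open>y\<close> be the subsequence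
  of \<open>x\<close> along \<open>S\<close>. For a set \<open>U\<close> put \<open>B = {n. x n \<in> U}\<close> and \<open>C = {n. y n \<in> U}\<close>; then
  \<open>thin S C = B \<inter> S\<close>.

  If \<open>C \<notin> I\<close> and \<open>S\<close> has non-zero density, weak thinnability gives \<open>B \<inter> S \<notin> I\<close>, hence \<open>B \<notin> I\<close>.
  Therefore every cluster point of \<open>y\<close> is one of \<open>x\<close> as soon as \<open>S\<close> has non-zero density.

  If \<open>B \<notin> I\<close> and the indices \<open>j\<close> for which the \<open>j\<close>-th element of \<open>B\<close> lies in \<open>S\<close> form a set \<open>A\<close> of
  non-zero density, then \<open>B \<inter> S = thin B A \<notin> I\<close>. Since \<open>C\<close> is elementwise below \<open>B \<inter> S\<close>, also
  \<open>C \<notin> I\<close>. Here the exceptional null set of \<open>w\<close> depends on \<open>U\<close>, so only countably many \<open>U\<close> can be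
  treated at once. The topological hypotheses provide them: the set of cluster points of \<open>x\<close> is
  closed, hence has a countable dense subset, and the points of that subset have countable
  neighbourhood bases. Every open \<open>U\<close> around a cluster point of \<open>x\<close> contains a member \<open>V\<close> of one of
  these bases (\<open>countable_family_meeting_separable_set\<close>). As \<open>V\<close> contains a cluster point of \<open>x\<close>,
  it is visited by \<open>x\<close> along a set outside \<open>I\<close>, hence so it is by \<open>y\<close>, and then so is \<open>U\<close>.

  What is left is that almost every \<open>w\<close> has digit \<open>1\<close> with density \<open>1/2\<close> along any prescribed
  sequence of distinct positions (\<open>AE_nonzero_density_digits\<close>). As pairwise uncorrelated signs
  already satisfy a strong law of large numbers (\<open>strong_law_uncorrelated\<close>), it suffices that
  distinct Rademacher functions are orthogonal (\<open>rademacher_orthogonal\<close>).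
\<close>

section \<open>A strong law for bounded uncorrelated functions\<close>

lemma second_moment_sum_uncorrelated:
  fixes r :: "nat \<Rightarrow> 'a \<Rightarrow> real"
  assumes "finite_measure M"
    and [measurable]: "\<And>i. r i \<in> borel_measurable M"
    and bound: "\<And>i w. \<bar>r i w\<bar> \<le> 1"
    and orth: "\<And>i j. i \<noteq> j \<Longrightarrow> (\<integral>w. r i w * r j w \<partial>M) = 0"
  shows "integrable M (\<lambda>w. (\<Sum>j<n. r j w)\<^sup>2)"
    and "(\<integral>w. (\<Sum>j<n. r j w)\<^sup>2 \<partial>M) \<le> real n * measure M (space M)"
proof -
  interpret finite_measure M by fact
  have prod_le: "\<bar>r i w * r j w\<bar> \<le> 1" for i j w
    using mult_mono[OF bound[of i w] bound[of j w]] by (simp add: abs_mult)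
  have int: "integrable M (\<lambda>w. r i w * r j w)" for i j
    by (rule integrable_const_bound[of _ 1]) (use prod_le in auto)
  have sq: "(\<Sum>j<n. r j w)\<^sup>2 = (\<Sum>i<n. \<Sum>j<n. r i w * r j w)" for w
    by (simp add: power2_eq_square sum_product)
  show "integrable M (\<lambda>w. (\<Sum>j<n. r j w)\<^sup>2)"
    unfolding sq by (intro Bochner_Integration.integrable_sum int)
  have "(\<integral>w. (\<Sum>j<n. r j w)\<^sup>2 \<partial>M) = (\<Sum>i<n. \<Sum>j<n. \<integral>w. r i w * r j w \<partial>M)"
    unfolding sq by (simp add: Bochner_Integration.integral_sum int)
  also have "\<dots> = (\<Sum>i<n. \<integral>w. r i w * r i w \<partial>M)"
  proof (rule sum.cong)
    fix i assume "i \<in> {..<n}"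
    then show "(\<Sum>j<n. \<integral>w. r i w * r j w \<partial>M) = (\<integral>w. r i w * r i w \<partial>M)"
      by (subst sum.remove[of _ i]) (auto intro!: sum.neutral orth)
  qed simp
  also have "\<dots> \<le> (\<Sum>i<n. measure M (space M))"
  proof (rule sum_mono)
    fix i
    have "(\<integral>w. r i w * r i w \<partial>M) \<le> (\<integral>w. 1 \<partial>M)"
      by (rule integral_mono[OF int _ abs_le_D1[OF prod_le]]) simp
    then show "(\<integral>w. r i w * r i w \<partial>M) \<le> measure M (space M)" by simp
  qed
  finally show "(\<integral>w. (\<Sum>j<n. r j w)\<^sup>2 \<partial>M) \<le> real n * measure M (space M)" by simp
qed

text \<open>
  Between consecutive squares \<open>n\<^sup>2\<close> and \<open>(n + 1)\<^sup>2\<close> a sum of terms of modulus at most \<open>1\<close> changes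
  by at most \<open>2 n\<close>, which is negligible against \<open>n\<^sup>2\<close>. This is why a second moment bound suffices
  for the strong law below.
\<close>

lemma averages_tendsto_0_if_along_squares:
  fixes a :: "nat \<Rightarrow> real"
  assumes bound: "\<And>j. \<bar>a j\<bar> \<le> 1"
    and squares: "(\<lambda>n. (\<Sum>j<n\<^sup>2. a j) / real (n\<^sup>2)) \<longlonglongrightarrow> 0"
  shows "(\<lambda>m. (\<Sum>j<m. a j) / real m) \<longlonglongrightarrow> 0"
proof -
  define S where "S m = (\<Sum>j<m. a j)" for m
  have top: "filterlim floor_sqrt at_top sequentially"
    unfolding filterlim_at_top
  proof
    fix k
    show "\<forall>\<^sub>F m in sequentially. k \<le> floor_sqrt m"
      using eventually_ge_at_top[of "k\<^sup>2"] by eventually_elim (rule le_floor_sqrtI)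
  qed
  have "(\<lambda>n. \<bar>S (n\<^sup>2) / real (n\<^sup>2)\<bar> + 2 / real n) \<longlonglongrightarrow> 0 + 0"
    using squares unfolding S_def
    by (intro tendsto_add tendsto_rabs_zero lim_const_over_n)
  then have lim: "(\<lambda>m. \<bar>S ((floor_sqrt m)\<^sup>2) / real ((floor_sqrt m)\<^sup>2)\<bar> + 2 / real (floor_sqrt m))
      \<longlonglongrightarrow> 0"
    using filterlim_compose[OF _ top] by simp
  have "(\<lambda>m. S m / real m) \<longlonglongrightarrow> 0"
  proof (rule Lim_null_comparison[OF _ lim])
    show "\<forall>\<^sub>F m in sequentially. norm (S m / real m)
        \<le> \<bar>S ((floor_sqrt m)\<^sup>2) / real ((floor_sqrt m)\<^sup>2)\<bar> + 2 / real (floor_sqrt m)"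
      using eventually_gt_at_top[of 0]
    proof eventually_elim
      case (elim m)
      define n where "n = floor_sqrt m"
      have n: "n > 0" "n\<^sup>2 \<le> m" "m < (Suc n)\<^sup>2"
        using elim Suc_floor_sqrt_power2_gt[of m] by (auto simp: n_def)
      have gap: "m - n\<^sup>2 \<le> 2 * n"
        using n(3) by (simp add: power2_eq_square)
      have "S m = S (n\<^sup>2) + (\<Sum>j\<in>{n\<^sup>2..<m}. a j)"
        unfolding S_def using n(2) by (simp add: sum.atLeastLessThan_concat lessThan_atLeast0)
      moreover have "\<bar>\<Sum>j\<in>{n\<^sup>2..<m}. a j\<bar> \<le> real (m - n\<^sup>2)"
        using sum_norm_bound[of "{n\<^sup>2..<m}" a 1] bound by simp
      ultimately have "\<bar>S m\<bar> \<le> \<bar>S (n\<^sup>2)\<bar> + 2 * real n"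
        using gap by linarith
      then have "\<bar>S m\<bar> / real m \<le> (\<bar>S (n\<^sup>2)\<bar> + 2 * real n) / real (n\<^sup>2)"
        using n by (intro frac_le) auto
      also have "\<dots> = \<bar>S (n\<^sup>2) / real (n\<^sup>2)\<bar> + 2 / real n"
        using n(1) by (simp add: add_divide_distrib power2_eq_square)
      finally show ?case by (simp add: n_def)
    qed
  qed
  then show ?thesis by (simp add: S_def)
qed

text \<open>
  The second moment of the average over \<open>n\<^sup>2\<close> terms is \<open>O(1/n\<^sup>2)\<close>, so the squared averages along
  squares have a finite integrated sum and thus form a convergent series almost everywhere.
\<close>

lemma strong_law_uncorrelated:
  fixes r :: "nat \<Rightarrow> 'a \<Rightarrow> real"
  assumes "finite_measure M"
    and [measurable]: "\<And>i. r i \<in> borel_measurable M"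
    and bound: "\<And>i w. \<bar>r i w\<bar> \<le> 1"
    and orth: "\<And>i j. i \<noteq> j \<Longrightarrow> (\<integral>w. r i w * r j w \<partial>M) = 0"
  shows "AE w in M. (\<lambda>n. (\<Sum>j<n. r j w) / real n) \<longlonglongrightarrow> 0"
proof -
  interpret finite_measure M by fact
  define c where "c = measure M (space M)"
  define T where "T n w = ((\<Sum>j<n\<^sup>2. r j w) / real (n\<^sup>2))\<^sup>2" for n w
  have [measurable]: "T n \<in> borel_measurable M" for n
    unfolding T_def by measurable
  note moment = second_moment_sum_uncorrelated[OF assms]
  have T_eq: "T n w = (\<Sum>j<n\<^sup>2. r j w)\<^sup>2 / (real (n\<^sup>2))\<^sup>2" for n w
    by (simp add: T_def power_divide)
  have T_int: "integrable M (T n)" for n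
    unfolding T_eq using moment(1)[where n = "n\<^sup>2"] by simp
  have "(\<integral>\<^sup>+w. ennreal (T n w) \<partial>M) \<le> ennreal (c / (real n)\<^sup>2)" for n
  proof -
    have "(\<integral>w. T n w \<partial>M) \<le> real (n\<^sup>2) * c / (real (n\<^sup>2))\<^sup>2"
      unfolding T_eq using moment(2)[where n = "n\<^sup>2"]
      by (simp add: c_def divide_right_mono del: of_nat_power)
    also have "\<dots> = c / (real n)\<^sup>2"
      by (simp add: power2_eq_square)
    finally show ?thesis
      by (subst nn_integral_eq_integral[OF T_int]) (simp_all add: T_def[abs_def] ennreal_leI)
  qed
  then have "(\<integral>\<^sup>+w. (\<Sum>n. ennreal (T n w)) \<partial>M) \<le> (\<Sum>n. ennreal (c / (real n)\<^sup>2))"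
    by (subst nn_integral_suminf) (auto intro!: suminf_le)
  also have "\<dots> < \<infinity>"
  proof -
    have "summable (\<lambda>n. c * inverse ((real n)\<^sup>2))"
      by (intro summable_mult inverse_power_summable) simp
    then have "summable (\<lambda>n. c / (real n)\<^sup>2)"
      by (simp add: field_simps)
    then show ?thesis
      by (subst suminf_ennreal2) (auto simp: c_def)
  qed
  finally have "AE w in M. (\<Sum>n. ennreal (T n w)) \<noteq> \<infinity>"
    by (intro nn_integral_PInf_AE) auto
  then show ?thesis
  proof eventually_elim
    case (elim w)
    have "summable (\<lambda>n. T n w)"
      using elim by (intro summable_suminf_not_top) (auto simp: T_def)
    then have "(\<lambda>n. T n w) \<longlonglongrightarrow> 0"
      by (rule summable_LIMSEQ_zero)
    then have "(\<lambda>n. sqrt (T n w)) \<longlonglongrightarrow> sqrt 0"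
      by (rule tendsto_real_sqrt)
    then have "(\<lambda>n. (\<Sum>j<n\<^sup>2. r j w) / real (n\<^sup>2)) \<longlonglongrightarrow> 0"
      unfolding T_def real_sqrt_abs real_sqrt_zero by (rule tendsto_rabs_zero_cancel)
    then show ?case
      by (intro averages_tendsto_0_if_along_squares bound)
  qed
qed

section \<open>Rademacher functions and dyadic digits\<close>

text \<open>
  This is the square wave of period \<open>2\<close>. On \<open>{0<..1}\<close> the function \<open>\<lambda>w. sign_wave (2 ^ i * w)\<close> is
  the \<open>i\<close>-th Rademacher function, with value \<open>-1\<close> where the \<open>i\<close>-th digit is \<open>1\<close>. The ceiling
  makes the intervals of constancy closed on the right, as non-terminating expansions require.
\<close>

definition sign_wave :: "real \<Rightarrow> real" where
  "sign_wave u = (if even \<lceil>u\<rceil> then - 1 else 1)"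

lemma sign_wave_measurable [measurable]: "sign_wave \<in> borel_measurable borel"
  unfolding sign_wave_def[abs_def] by measurable

lemma abs_sign_wave [simp]: "\<bar>sign_wave u\<bar> = 1"
  by (simp add: sign_wave_def)

lemma sign_wave_add_1: "sign_wave (u + 1) = - sign_wave u"
  by (simp add: sign_wave_def)

lemma sign_wave_add_2_mult: "sign_wave (u + 2 * real k) = sign_wave u"
proof (induction k)
  case (Suc k)
  have "sign_wave (u + 2 * real (Suc k)) = sign_wave (u + 2 * real k + 1 + 1)"
    by (simp add: algebra_simps)
  then show ?case using Suc by (simp only: sign_wave_add_1 minus_minus)
qed simp

lemma sign_wave_pow2_periodic:
  assumes "1 \<le> i"
  shows "sign_wave (2 ^ i * (w + 1)) = sign_wave (2 ^ i * w)"
proof -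
  obtain k where "i = Suc k" using assms by (cases i) auto
  then have "2 ^ i * (w + 1) = 2 ^ i * w + 2 * real (2 ^ k)"
    by (simp add: algebra_simps)
  then show ?thesis by (simp only: sign_wave_add_2_mult)
qed

text \<open>
  Translating by \<open>h\<close> changes the sign of the integral over a full period, whereas periodicity says
  that the integral does not depend on where the period starts.
\<close>

lemma integral_periodic_antiperiodic_eq_0:
  fixes f :: "real \<Rightarrow> real"
  assumes [measurable]: "f \<in> borel_measurable borel"
    and bound: "\<And>w. \<bar>f w\<bar> \<le> C"
    and periodic: "\<And>w. f (w + 1) = f w"
    and anti: "\<And>w. f (w + h) = - f w"
    and h: "0 \<le> h" "h \<le> 1"
  shows "(\<integral>w. indicator {0<..1} w *\<^sub>R f w \<partial>lborel) = 0"
proof -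
  define J where "J a b = (\<integral>w. indicator {a<..b} w *\<^sub>R f w \<partial>lborel)" for a b
  have int: "integrable lborel (\<lambda>w. indicator {a<..b} w *\<^sub>R f w)" for a b
  proof (rule integrableI_bounded_set_indicator[of _ _ _ C])
    show "emeasure lborel {a<..b} < \<infinity>" by (cases "a \<le> b") auto
  qed (use bound in auto)
  have shift: "J a b = (\<integral>w. indicator {a - t<..b - t} w *\<^sub>R f (w + t) \<partial>lborel)" for a b t
    unfolding J_def
    by (subst lborel_integral_real_affine[where c=1 and t=t])
       (auto intro!: Bochner_Integration.integral_cong simp: indicator_def add.commute)
  have split: "J a c = J a b + J b c" if "a \<le> b" "b \<le> c" for a b c
    unfolding J_def using that
    by (subst Bochner_Integration.integral_add[symmetric, OF int int])
       (auto intro!: Bochner_Integration.integral_cong simp: indicator_def)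
  have "J 0 1 = - J (- h) (1 - h)"
    using shift[of 0 1 h] by (simp add: anti J_def)
  moreover have "J (- h) 0 = J (1 - h) 1"
    using shift[of "1 - h" 1 1] by (simp add: periodic J_def)
  ultimately have "J 0 1 = - J 0 1"
    using split[of "- h" 0 "1 - h"] split[of 0 "1 - h" 1] h by simp
  then show ?thesis by (simp add: J_def)
qed

text \<open>
  The shift by \<open>2\<^sup>-\<^sup>i\<close>, where \<open>i\<close> is the smaller index, flips the coarser function and is a period
  of the finer one.
\<close>

lemma rademacher_orthogonal:
  assumes "1 \<le> i" "1 \<le> j" "i \<noteq> j"
  shows "(\<integral>w. sign_wave (2 ^ i * w) * sign_wave (2 ^ j * w)
            \<partial>(restrict_space lborel {0<..1})) = 0"
  using assms
proof (induction i j rule: linorder_wlog)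
  case (le i j)
  then obtain k where k: "j = Suc (i + k)"
    using less_imp_Suc_add[of i j] by auto
  have "(\<integral>w. indicator {0<..1} w *\<^sub>R (sign_wave (2 ^ i * w) * sign_wave (2 ^ j * w)) \<partial>lborel) = 0"
  proof (rule integral_periodic_antiperiodic_eq_0[where C = 1 and h = "1 / 2 ^ i"])
    fix w :: real
    have "2 ^ i * (w + 1 / 2 ^ i) = 2 ^ i * w + 1"
      by (simp add: algebra_simps)
    moreover have "2 ^ j * (w + 1 / 2 ^ i) = 2 ^ j * w + 2 * real (2 ^ k)"
      by (simp add: k algebra_simps power_add)
    ultimately show "sign_wave (2 ^ i * (w + 1 / 2 ^ i)) * sign_wave (2 ^ j * (w + 1 / 2 ^ i))
        = - (sign_wave (2 ^ i * w) * sign_wave (2 ^ j * w))"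
      by (simp only: sign_wave_add_1 sign_wave_add_2_mult mult_minus_left)
  qed (use le in \<open>auto simp: sign_wave_pow2_periodic abs_mult\<close>)
  then show ?case
    by (simp add: integral_restrict_space)
next
  case (sym i j)
  then show ?case by (simp add: mult.commute)
qed

lemma nonterminating_dyadic_digit:
  "w \<in> {0<..1} \<Longrightarrow> nonterminating_dyadic w (dyadic_digit w)"
  unfolding dyadic_digit_def by (rule theI'[OF ex1_nonterminating_dyadic])

text \<open>
  The tail of the expansion after \<open>n\<close> digits lies in \<open>{0<..1}\<close> after scaling, so the ceiling of
  \<open>2 ^ n * w\<close> exceeds the integer spelled by the first \<open>n\<close> digits by exactly one; its parity is
  that of the last of these digits, reversed.
\<close>

lemma sign_wave_eq_dyadic_digit:
  assumes w: "w \<in> {0<..1}" and i: "1 \<le> i"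
  shows "sign_wave (2 ^ i * w) = 1 - 2 * real (dyadic_digit w i)"
proof -
  define d where "d = dyadic_digit w"
  have D: "nonterminating_dyadic w d"
    using nonterminating_dyadic_digit[OF w] by (simp add: d_def)
  then have d: "d i \<in> {0, 1}" by (auto simp: nonterminating_dyadic_def)
  have ex: "\<exists>N::int. 2 ^ n * (\<Sum>i<n. real (d (Suc i)) / 2 ^ Suc i) = real_of_int N" for n
  proof (induction n)
    case 0
    show ?case by (intro exI[of _ 0]) simp
  next
    case (Suc n)
    then obtain N :: int
      where "2 ^ n * (\<Sum>i<n. real (d (Suc i)) / 2 ^ Suc i) = real_of_int N" ..
    then show ?case
      by (intro exI[of _ "2 * N + int (d (Suc n))"]) (simp add: algebra_simps)
  qed
  obtain k where k: "i = Suc k" using i by (cases i) auto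
  obtain N :: int where N: "2 ^ k * (\<Sum>i<k. real (d (Suc i)) / 2 ^ Suc i) = real_of_int N"
    using ex by blast
  have "2 ^ i * (\<Sum>i<i. real (d (Suc i)) / 2 ^ Suc i) = 2 * real_of_int N + real (d i)"
    using N by (simp add: k algebra_simps)
  then have "2 ^ i * w - (2 * real_of_int N + real (d i)) \<in> {0<..1}"
    using nonterminating_dyadic_tail[OF D, of i] by (simp add: right_diff_distrib)
  then have "\<lceil>2 ^ i * w\<rceil> = 2 * N + int (d i) + 1"
    by (simp add: ceiling_eq_iff)
  then show ?thesis
    using d by (auto simp: sign_wave_def d_def)
qed

text \<open>
  The first \<open>n\<close> selected digits contain as many ones as half the difference between \<open>n\<close> and the
  sum of the corresponding Rademacher functions, and that sum is \<open>o(n)\<close> by the strong law.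
\<close>

lemma AE_nonzero_density_digits:
  fixes b :: "nat \<Rightarrow> nat"
  assumes inj: "inj_on b {1..}" and pos: "b ` {1..} \<subseteq> {1..}"
  shows "AE w in restrict_space lborel {0<..1}.
           nonzero_density {j. 1 \<le> j \<and> dyadic_digit w (b j) = 1}"
proof -
  let ?M = "restrict_space lborel {0<..1::real}"
  define r where "r j w = sign_wave (2 ^ b (Suc j) * w)" for j w
  have "finite_measure ?M"
    by (rule finite_measureI) (simp add: emeasure_restrict_space space_restrict_space)
  moreover have "r j \<in> borel_measurable ?M" for j
    unfolding r_def[abs_def] by (rule measurable_restrict_space1) measurable
  moreover have "(\<integral>w. r i w * r j w \<partial>?M) = 0" if "i \<noteq> j" for i j
    unfolding r_def
  proof (rule rademacher_orthogonal)
    show "1 \<le> b (Suc i)" "1 \<le> b (Suc j)" using pos by (auto simp: image_subset_iff)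
    show "b (Suc i) \<noteq> b (Suc j)" using inj that by (auto dest: inj_onD)
  qed
  moreover have "\<bar>r j w\<bar> \<le> 1" for j w
    by (simp add: r_def)
  ultimately have "AE w in ?M. (\<lambda>n. (\<Sum>j<n. r j w) / real n) \<longlonglongrightarrow> 0"
    by (intro strong_law_uncorrelated)
  then show ?thesis
    using AE_space
  proof eventually_elim
    case (elim w)
    then have w: "w \<in> {0<..1}" by (simp add: space_restrict_space)
    define A where "A = {j. 1 \<le> j \<and> dyadic_digit w (b j) = 1}"
    have digit: "dyadic_digit w j \<in> {0, 1}" for j
      using nonterminating_dyadic_digit[OF w] by (auto simp: nonterminating_dyadic_def)
    have card: "real (card (A \<inter> {1..n})) = (\<Sum>j<n. real (dyadic_digit w (b (Suc j))))" for n
    proof -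
      have "real (card (A \<inter> {1..n})) = (\<Sum>j\<in>{1..n} \<inter> A. 1)"
        by (simp add: Int_commute)
      also have "\<dots> = (\<Sum>j\<in>{1..n}. if j \<in> A then 1 else 0)"
        by (rule sum.inter_restrict) simp
      also have "\<dots> = (\<Sum>j\<in>{1..n}. real (dyadic_digit w (b j)))"
        proof (rule sum.cong)
        fix j assume "j \<in> {1..n}"
        then show "(if j \<in> A then 1 else 0) = real (dyadic_digit w (b j))"
          using digit[of "b j"] by (auto simp: A_def)
      qed simp
      also have "\<dots> = (\<Sum>j<n. real (dyadic_digit w (b (Suc j))))"
        using sum.atLeast1_atMost_eq[of "\<lambda>j. real (dyadic_digit w (b j))" n] by simp
      finally show ?thesis .
    qed
    have "r j w = 1 - 2 * real (dyadic_digit w (b (Suc j)))" for j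
      unfolding r_def using w pos by (intro sign_wave_eq_dyadic_digit) (auto simp: image_subset_iff)
    then have sum_r: "(\<Sum>j<n. r j w) = real n - 2 * real (card (A \<inter> {1..n}))" for n
      by (simp add: card sum_subtractf sum_distrib_left[symmetric] del: One_nat_def)
    then have half: "(1 - (\<Sum>j<n. r j w) / real n) / 2 = real (card (A \<inter> {1..n})) / real n"
      if "0 < n" for n using that by (simp add: sum_r diff_divide_distrib)
    have "(\<lambda>n. (1 - (\<Sum>j<n. r j w) / real n) / 2) \<longlonglongrightarrow> (1 - 0) / 2"
      using elim(1) by (intro tendsto_intros) auto
    moreover have "\<forall>\<^sub>F n in sequentially.
        (1 - (\<Sum>j<n. r j w) / real n) / 2 = real (card (A \<inter> {1..n})) / real n"
      using eventually_gt_at_top[of 0] by eventually_elim (rule half)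
    ultimately have "(\<lambda>n. real (card (A \<inter> {1..n})) / real n) \<longlonglongrightarrow> (1 - 0) / 2"
      by (rule Lim_transform_eventually)
    then show ?case
      unfolding nonzero_density_def A_def[symmetric] by (intro exI[of _ "1 / 2"]) simp
  qed
qed

section \<open>Enumerations of infinite sets of positive integers\<close>

lemma nth_elem_in: "infinite S \<Longrightarrow> nth_elem S n \<in> S"
  by (simp add: nth_elem_def enumerate_in_set)

lemma nth_elem_less: "infinite S \<Longrightarrow> 1 \<le> m \<Longrightarrow> m < n \<Longrightarrow> nth_elem S m < nth_elem S n"
  by (simp add: nth_elem_def)

lemma inj_on_nth_elem: "infinite S \<Longrightarrow> inj_on (nth_elem S) {1..}"
  by (rule strict_mono_on_imp_inj_on) (simp add: strict_mono_on_def nth_elem_less)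

lemma nth_elem_surj:
  assumes "infinite S" "s \<in> S"
  obtains n where "1 \<le> n" "nth_elem S n = s"
proof -
  obtain m where "enumerate S m = s"
    using enumerate_Ex assms by blast
  then show ?thesis by (intro that[of "Suc m"]) (simp_all add: nth_elem_def)
qed

lemma le_nth_elem:
  assumes S: "infinite S" "S \<subseteq> {1..}"
  shows "n \<le> nth_elem S n"
proof (induction n)
  case (Suc n)
  show ?case
  proof (cases n)
    case 0
    then show ?thesis using nth_elem_in[OF S(1), of 1] S(2) by auto
  next
    case (Suc m)
    then show ?thesis using Suc.IH nth_elem_less[OF S(1), of n "Suc n"] by simp
  qed
qed simp

lemma enumerate_image:
  fixes f :: "nat \<Rightarrow> nat"
  assumes inf: "infinite C" and mono: "strict_mono_on C f"
  shows "enumerate (f ` C) n = f (enumerate C n)"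
proof -
  have infim: "infinite (f ` C)"
    using inf strict_mono_on_imp_inj_on[OF mono] by (simp add: finite_image_iff)
  have less: "f a < f b \<longleftrightarrow> a < b" if "a \<in> C" "b \<in> C" for a b
    using that strict_mono_on_less[OF mono] by blast
  have le: "f a \<le> f b \<longleftrightarrow> a \<le> b" if "a \<in> C" "b \<in> C" for a b
    using that strict_mono_on_less_eq[OF mono] by blast
  have inC: "enumerate C k \<in> C" for k
    using inf by (rule enumerate_in_set)
  show ?thesis
  proof (induction n)
    case 0
    show ?case unfolding enumerate_0
    proof (rule Least_equality)
      show "f (LEAST n. n \<in> C) \<in> f ` C" using inC[of 0] by (simp add: enumerate_0)
      show "f (LEAST n. n \<in> C) \<le> y" if "y \<in> f ` C" for y
        using that inC[of 0] by (auto simp: enumerate_0 le intro: Least_le)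
    qed
  next
    case (Suc n)
    have "(LEAST s. s \<in> f ` C \<and> f (enumerate C n) < s) = f (enumerate C (Suc n))"
    proof (rule Least_equality)
      show "f (enumerate C (Suc n)) \<in> f ` C \<and> f (enumerate C n) < f (enumerate C (Suc n))"
        using inC inf by (auto simp: less)
      fix y assume "y \<in> f ` C \<and> f (enumerate C n) < y"
      then obtain c where c: "c \<in> C" "y = f c" "enumerate C n < c"
        using inC less by auto
      then have "enumerate C (Suc n) \<le> c"
        by (simp add: enumerate_Suc''[OF inf] Least_le)
      then show "f (enumerate C (Suc n)) \<le> y"
        using c inC by (simp add: le)
    qed
    then show ?case by (simp add: enumerate_Suc''[OF infim] Suc)
  qed
qed

lemma enum_le_thin:
  assumes S: "infinite S" "S \<subseteq> {1..}" and C: "infinite C" "C \<subseteq> {1..}"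
  shows "enum_le C (thin S C)"
proof -
  have "strict_mono_on C (nth_elem S)"
    using C(2) nth_elem_less[OF S(1)] by (auto intro!: strict_mono_onI)
  then show ?thesis
    using le_nth_elem[OF S] enumerate_image[OF C(1)]
    by (simp add: enum_le_def thin_def nth_elem_def[of C] nth_elem_def[of "nth_elem S ` C"])
qed

text \<open>
  The intersection of two sets is obtained by thinning either of them; both readings are used
  below.
\<close>

lemma thin_positions_eq_Int:
  assumes "infinite S"
  shows "thin S {n. 1 \<le> n \<and> nth_elem S n \<in> B} = S \<inter> B"
proof (intro equalityI subsetI)
  fix s assume "s \<in> S \<inter> B"
  moreover from this obtain n where "1 \<le> n" "nth_elem S n = s"
    using nth_elem_surj[OF assms] by blast
  ultimately show "s \<in> thin S {n. 1 \<le> n \<and> nth_elem S n \<in> B}"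
    unfolding thin_def by blast
qed (use nth_elem_in[OF assms] in \<open>auto simp: thin_def\<close>)

lemma nonzero_density_imp_infinite:
  assumes "nonzero_density A"
  shows "infinite A"
proof
  assume fin: "finite A"
  obtain d where d: "d > 0" "(\<lambda>n. real (card (A \<inter> {1..n})) / real n) \<longlonglongrightarrow> d"
    using assms by (auto simp: nonzero_density_def)
  have "(\<lambda>n. real (card (A \<inter> {1..n})) / real n) \<longlonglongrightarrow> 0"
  proof (rule Lim_null_comparison)
    show "\<forall>\<^sub>F n in sequentially.
        norm (real (card (A \<inter> {1..n})) / real n) \<le> real (card A) / real n"
      using card_mono[OF fin, of "A \<inter> {1.._}"] by (auto intro!: always_eventually divide_right_mono)
    show "(\<lambda>n. real (card A) / real n) \<longlonglongrightarrow> 0"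
      by (rule lim_const_over_n)
  qed
  then show False using d LIMSEQ_unique by fastforce
qed

section \<open>Positive sets and cluster points along a subsequence\<close>

lemma ideal_on_pos_subset: "ideal_on_pos I \<Longrightarrow> A \<in> I \<Longrightarrow> B \<subseteq> A \<Longrightarrow> B \<in> I"
  by (simp add: ideal_on_pos_def)

lemma ideal_on_pos_finite: "ideal_on_pos I \<Longrightarrow> A \<subseteq> {1..} \<Longrightarrow> finite A \<Longrightarrow> A \<in> I"
  by (simp add: ideal_on_pos_def)

lemma positive_if_positive_along:
  assumes I: "weakly_thinnable I" and S: "S \<subseteq> {1..}" "nonzero_density S"
    and C: "{n. 1 \<le> n \<and> nth_elem S n \<in> B} \<notin> I"
  shows "B \<notin> I"
proof -
  have "thin S {n. 1 \<le> n \<and> nth_elem S n \<in> B} \<notin> I"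
  proof -
    have "{n. 1 \<le> n \<and> nth_elem S n \<in> B} \<subseteq> {1..}" by auto
    then show ?thesis using I S C unfolding weakly_thinnable_def by blast
  qed
  then have "S \<inter> B \<notin> I"
    using thin_positions_eq_Int[OF nonzero_density_imp_infinite[OF S(2)], of B] by simp
  then show ?thesis
    using I ideal_on_pos_subset[of I B "S \<inter> B"] by (auto simp: weakly_thinnable_def)
qed

text \<open>
  Thinning \<open>B\<close> by the indices of its elements in \<open>S\<close> gives the same set \<open>S \<inter> B\<close> as thinning \<open>S\<close> by
  the set in the conclusion. So \<open>S \<inter> B\<close> is not in \<open>I\<close>, and monotonicity of \<open>I\<close> under the elementwise
  order passes this on to the set of indices, whose elements are no larger.
\<close>

lemma positive_along_if_positive:
  assumes I: "thinnable I" and B: "B \<subseteq> {1..}" "B \<notin> I" and S: "infinite S" "S \<subseteq> {1..}"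
    and dens: "nonzero_density {j. 1 \<le> j \<and> nth_elem B j \<in> S}"
  shows "{n. 1 \<le> n \<and> nth_elem S n \<in> B} \<notin> I"
proof -
  let ?C = "{n. 1 \<le> n \<and> nth_elem S n \<in> B}"
  have ideal: "ideal_on_pos I"
    using I by (simp add: thinnable_def weakly_thinnable_def)
  have "infinite B"
    using B ideal_on_pos_finite[OF ideal] by blast
  moreover have "thin B {j. 1 \<le> j \<and> nth_elem B j \<in> S} \<notin> I"
  proof -
    have "{j. 1 \<le> j \<and> nth_elem B j \<in> S} \<subseteq> {1..}" by auto
    then show ?thesis using I B dens unfolding thinnable_def by blast
  qed
  ultimately have pos: "thin S ?C \<notin> I"
    using thin_positions_eq_Int[of B S] thin_positions_eq_Int[OF S(1), of B]
    by (simp add: Int_commute)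
  have sub: "thin S ?C \<subseteq> {1..}"
    using S(2) thin_positions_eq_Int[OF S(1), of B] by auto
  have inf: "infinite (thin S ?C)"
    using pos sub ideal_on_pos_finite[OF ideal] by blast
  then have infC: "infinite ?C"
    by (auto simp: thin_def)
  have "?C \<subseteq> {1..}" by auto
  moreover from this have "enum_le ?C (thin S ?C)"
    by (intro enum_le_thin S infC)
  ultimately show ?thesis
    using I pos sub inf infC unfolding thinnable_def by blast
qed

lemma ideal_cluster_points_iff:
  assumes "ideal_on_pos I"
  shows "l \<in> ideal_cluster_points X I x \<longleftrightarrow>
    l \<in> topspace X \<and> (\<forall>V. openin X V \<and> l \<in> V \<longrightarrow> {n. 1 \<le> n \<and> x n \<in> V} \<notin> I)"
proof (intro iffI conjI allI impI)
  assume l: "l \<in> ideal_cluster_points X I x"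
  then show "l \<in> topspace X"
    by (simp add: ideal_cluster_points_def)
  fix V assume V: "openin X V \<and> l \<in> V"
  then have "V \<subseteq> topspace X" by (simp add: openin_subset)
  moreover have "\<exists>W. openin X W \<and> l \<in> W \<and> W \<subseteq> V" using V by (intro exI[of _ V]) simp
  ultimately show "{n. 1 \<le> n \<and> x n \<in> V} \<notin> I"
    using l unfolding ideal_cluster_points_def mem_Collect_eq by simp
next
  assume r: "l \<in> topspace X \<and> (\<forall>V. openin X V \<and> l \<in> V \<longrightarrow> {n. 1 \<le> n \<and> x n \<in> V} \<notin> I)"
  have "{n. 1 \<le> n \<and> x n \<in> U} \<notin> I" if "openin X V" "l \<in> V" "V \<subseteq> U" for U V
  proof
    assume "{n. 1 \<le> n \<and> x n \<in> U} \<in> I"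
    moreover have "{n. 1 \<le> n \<and> x n \<in> V} \<subseteq> {n. 1 \<le> n \<and> x n \<in> U}" using that(3) by auto
    ultimately have "{n. 1 \<le> n \<and> x n \<in> V} \<in> I" by (rule ideal_on_pos_subset[OF assms])
    then show False using r that(1,2) by simp
  qed
  then show "l \<in> ideal_cluster_points X I x"
    using r unfolding ideal_cluster_points_def by auto
qed

lemma closedin_ideal_cluster_points:
  assumes "ideal_on_pos I"
  shows "closedin X (ideal_cluster_points X I x)"
proof -
  let ?G = "ideal_cluster_points X I x"
  have "\<exists>V. openin X V \<and> l \<in> V \<and> V \<subseteq> topspace X - ?G" if l: "l \<in> topspace X - ?G" for l
  proof -
    obtain V where V: "openin X V" "l \<in> V" "{n. 1 \<le> n \<and> x n \<in> V} \<in> I"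
      using l unfolding Diff_iff ideal_cluster_points_iff[OF assms] by blast
    have "m \<notin> ?G" if "m \<in> V" for m
      using V(1,3) that by (auto simp: ideal_cluster_points_iff[OF assms])
    then have "V \<subseteq> topspace X - ?G"
      using openin_subset[OF V(1)] by auto
    with V(1,2) show ?thesis by (intro exI[of _ V] conjI)
  qed
  then have "openin X (topspace X - ?G)"
    by (intro openin_subopen[THEN iffD2] ballI)
  moreover have "?G \<subseteq> topspace X"
    by (auto simp: ideal_cluster_points_def)
  ultimately show ?thesis by (simp add: closedin_def)
qed

text \<open>
  Members of a neighbourhood base at a point of a dense subset of \<open>C\<close> meet \<open>C\<close> in that point, and
  every open set that meets \<open>C\<close> contains such a member.
\<close>

lemma countable_family_meeting_separable_set:
  assumes "first_countable X" and "C \<subseteq> topspace X" and "separable_space (subtopology X C)"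
  obtains \<V> where "countable \<V>" "\<And>V. V \<in> \<V> \<Longrightarrow> openin X V"
    "\<And>V. V \<in> \<V> \<Longrightarrow> V \<inter> C \<noteq> {}"
    "\<And>U. openin X U \<Longrightarrow> U \<inter> C \<noteq> {} \<Longrightarrow> \<exists>V\<in>\<V>. V \<subseteq> U"
proof -
  have top: "topspace (subtopology X C) = C"
    using assms(2) by (simp add: topspace_subtopology Int_absorb1)
  obtain D where D: "countable D" "D \<subseteq> C" "subtopology X C closure_of D = C"
    using assms(3) unfolding separable_space_def top by blast
  define base where "base d \<B> \<longleftrightarrow> countable \<B> \<and> (\<forall>V\<in>\<B>. openin X V) \<and>
      (\<forall>U. openin X U \<and> d \<in> U \<longrightarrow> (\<exists>V\<in>\<B>. d \<in> V \<and> V \<subseteq> U))" for d \<B>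
  have "\<exists>\<B>. base d \<B>" if "d \<in> D" for d
    using assms(1,2) D(2) that unfolding first_countable_def base_def by blast
  then obtain \<B> where base: "\<And>d. d \<in> D \<Longrightarrow> base d (\<B> d)"
    by metis
  have \<B>: "countable (\<B> d)" "V \<in> \<B> d \<Longrightarrow> openin X V"
    "openin X U \<Longrightarrow> d \<in> U \<Longrightarrow> \<exists>V\<in>\<B> d. d \<in> V \<and> V \<subseteq> U" if "d \<in> D" for d U V
    using base[OF that] by (auto simp: base_def)
  show ?thesis
  proof (rule that[of "\<Union>d\<in>D. {V \<in> \<B> d. d \<in> V}"])
    show "countable (\<Union>d\<in>D. {V \<in> \<B> d. d \<in> V})"
      using D(1) \<B>(1) by (intro countable_UN countable_Collect)
    show "openin X V" if "V \<in> (\<Union>d\<in>D. {V \<in> \<B> d. d \<in> V})" for V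
      using that \<B>(2) by blast
    show "V \<inter> C \<noteq> {}" if "V \<in> (\<Union>d\<in>D. {V \<in> \<B> d. d \<in> V})" for V
      using that D(2) by blast
    show "\<exists>V\<in>(\<Union>d\<in>D. {V \<in> \<B> d. d \<in> V}). V \<subseteq> U" if U: "openin X U" "U \<inter> C \<noteq> {}" for U
    proof -
      obtain l where l: "l \<in> U" "l \<in> C" using U(2) by blast
      then have "l \<in> subtopology X C closure_of D" by (simp add: D(3))
      moreover have "openin (subtopology X C) (U \<inter> C)"
        using U(1) by (auto simp: openin_subtopology)
      ultimately obtain d where "d \<in> D" "d \<in> U"
        using l by (auto simp: in_closure_of)
      then show ?thesis using \<B>(3)[OF \<open>d \<in> D\<close> U(1)] by blast
    qed
  qed
qed

text \<open>
  For random \<open>S\<close> and countable \<open>\<V>\<close>, the density hypotheses hold almost surely; nothing else about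
  \<open>S\<close> is random in the argument.
\<close>

lemma ideal_cluster_points_along_eq:
  fixes x :: "nat \<Rightarrow> 'a"
  assumes I: "thinnable I" and S: "S \<subseteq> {1..}" "nonzero_density S"
    and \<V>_open: "\<And>V. V \<in> \<V> \<Longrightarrow> openin X V"
    and \<V>_meets: "\<And>V. V \<in> \<V> \<Longrightarrow> V \<inter> ideal_cluster_points X I x \<noteq> {}"
    and \<V>_fine: "\<And>U. openin X U \<Longrightarrow> U \<inter> ideal_cluster_points X I x \<noteq> {} \<Longrightarrow> \<exists>V\<in>\<V>. V \<subseteq> U"
    and dens: "\<And>V. V \<in> \<V> \<Longrightarrow> nonzero_density {j. 1 \<le> j \<and> nth_elem {n. 1 \<le> n \<and> x n \<in> V} j \<in> S}"
  shows "ideal_cluster_points X I x = ideal_cluster_points X I (\<lambda>n. x (nth_elem S n))"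
proof -
  have wI: "weakly_thinnable I" and ideal: "ideal_on_pos I"
    using I by (simp_all add: thinnable_def weakly_thinnable_def)
  have infS: "infinite S"
    using S(2) by (rule nonzero_density_imp_infinite)
  have hits: "{n. 1 \<le> n \<and> x (nth_elem S n) \<in> U}
      = {n. 1 \<le> n \<and> nth_elem S n \<in> {n. 1 \<le> n \<and> x n \<in> U}}" for U
    using S(1) nth_elem_in[OF infS] by auto
  show ?thesis
  proof (intro equalityI subsetI)
    fix l assume l: "l \<in> ideal_cluster_points X I (\<lambda>n. x (nth_elem S n))"
    have "{n. 1 \<le> n \<and> x n \<in> V} \<notin> I" if "openin X V" "l \<in> V" for V
    proof (rule positive_if_positive_along[OF wI S])
      show "{n. 1 \<le> n \<and> nth_elem S n \<in> {n. 1 \<le> n \<and> x n \<in> V}} \<notin> I"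
        using l that unfolding ideal_cluster_points_iff[OF ideal] hits[symmetric] by simp
    qed
    then show "l \<in> ideal_cluster_points X I x"
      using l by (simp add: ideal_cluster_points_iff[OF ideal])
  next
    fix l assume l: "l \<in> ideal_cluster_points X I x"
    have "{n. 1 \<le> n \<and> x (nth_elem S n) \<in> U} \<notin> I" if U: "openin X U" "l \<in> U" for U
    proof -
      obtain V where V: "V \<in> \<V>" "V \<subseteq> U"
        using \<V>_fine[OF U(1)] U(2) l by blast
      obtain m where "m \<in> V" "m \<in> ideal_cluster_points X I x"
        using \<V>_meets[OF V(1)] by blast
      then have "{n. 1 \<le> n \<and> x n \<in> V} \<notin> I"
        using \<V>_open[OF V(1)] by (simp add: ideal_cluster_points_iff[OF ideal])
      moreover have "{n. 1 \<le> n \<and> x n \<in> V} \<subseteq> {1..}" by auto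
      ultimately have "{n. 1 \<le> n \<and> x (nth_elem S n) \<in> V} \<notin> I"
        unfolding hits by (intro positive_along_if_positive[OF I _ _ infS S(1) dens[OF V(1)]])
      moreover have "{n. 1 \<le> n \<and> x (nth_elem S n) \<in> V} \<subseteq> {n. 1 \<le> n \<and> x (nth_elem S n) \<in> U}"
        using V(2) by auto
      ultimately show ?thesis
        using ideal_on_pos_subset[OF ideal] by metis
    qed
    then show "l \<in> ideal_cluster_points X I (\<lambda>n. x (nth_elem S n))"
      using l by (simp add: ideal_cluster_points_iff[OF ideal])
  qed
qed

section \<open>Almost every subsequence\<close>

text \<open>
  Measurability comes from completeness of the measure: the complement is contained in a null set.
\<close>

lemma AE_unit_imp_emeasure_unit_lebesgue_eq_1:
  assumes "AE w in restrict_space lborel {0<..1}. P w"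
  shows "{w \<in> {0<..1}. P w} \<in> sets unit_lebesgue \<and> emeasure unit_lebesgue {w \<in> {0<..1}. P w} = 1"
proof -
  have space: "space unit_lebesgue = {0<..1}"
    by (simp add: unit_lebesgue_def space_restrict_space)
  have ae: "AE w in unit_lebesgue. P w"
    unfolding unit_lebesgue_def using assms by (rule AE_completion)
  have "Measurable.pred unit_lebesgue (\<lambda>w. \<not> P w)"
    unfolding unit_lebesgue_def using assms by (intro sets_completion_AE) simp
  then have "Measurable.pred unit_lebesgue (\<lambda>w. \<not> \<not> P w)"
    by (rule pred_intros_logic)
  then have sets: "{w \<in> {0<..1}. P w} \<in> sets unit_lebesgue"
    by (simp add: pred_def space)
  have "emeasure unit_lebesgue {w \<in> {0<..1}. P w} = emeasure unit_lebesgue (space unit_lebesgue)"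
    using ae by (intro emeasure_eq_AE sets sets.top) (auto simp: space elim: eventually_mono)
  also have "\<dots> = 1"
  proof -
    have "{0<..1} \<in> sets (restrict_space lborel {0<..1::real})"
      by (auto simp: sets_restrict_space)
    then show ?thesis
      unfolding space by (simp add: unit_lebesgue_def emeasure_restrict_space)
  qed
  finally show ?thesis using sets by simp
qed

theorem theorem3p1:
  fixes X :: "'a topology" and x :: "nat \<Rightarrow> 'a" and I :: "nat set set"
  assumes "thinnable I"
    and "first_countable X"
    and "\<And>C. closedin X C \<Longrightarrow> separable_space (subtopology X C)"
    and "\<And>n. 1 \<le> n \<Longrightarrow> x n \<in> topspace X"
  shows "{w \<in> {0<..1}. ideal_cluster_points X I x = ideal_cluster_points X I (subseq_along x w)}
           \<in> sets unit_lebesgue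
       \<and> emeasure unit_lebesgue
           {w \<in> {0<..1}. ideal_cluster_points X I x = ideal_cluster_points X I (subseq_along x w)}
           = 1"
proof (rule AE_unit_imp_emeasure_unit_lebesgue_eq_1)
  let ?G = "ideal_cluster_points X I x"
  let ?hits = "\<lambda>V. {n. 1 \<le> n \<and> x n \<in> V}"
  have ideal: "ideal_on_pos I"
    using assms(1) by (simp add: thinnable_def weakly_thinnable_def)
  have closed: "closedin X ?G"
    using ideal by (rule closedin_ideal_cluster_points)
  obtain \<V> where \<V>: "countable \<V>" "\<And>V. V \<in> \<V> \<Longrightarrow> openin X V"
    "\<And>V. V \<in> \<V> \<Longrightarrow> V \<inter> ?G \<noteq> {}"
    "\<And>U. openin X U \<Longrightarrow> U \<inter> ?G \<noteq> {} \<Longrightarrow> \<exists>V\<in>\<V>. V \<subseteq> U"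
    using countable_family_meeting_separable_set[OF assms(2) closedin_subset[OF closed]
        assms(3)[OF closed]] by blast
  have inf: "infinite (?hits V)" if V: "V \<in> \<V>" for V
  proof -
    obtain m where "m \<in> V" "m \<in> ?G"
      using \<V>(3)[OF V] by blast
    then have "?hits V \<notin> I"
      using \<V>(2)[OF V] by (simp add: ideal_cluster_points_iff[OF ideal])
    moreover have "?hits V \<subseteq> {1..}" by auto
    ultimately show ?thesis using ideal_on_pos_finite[OF ideal] by blast
  qed
  have "AE w in restrict_space lborel {0<..1}.
      nonzero_density {j. 1 \<le> j \<and> dyadic_digit w j = 1}"
    using AE_nonzero_density_digits[of "\<lambda>j. j"] by simp
  moreover have "AE w in restrict_space lborel {0<..1}. \<forall>V\<in>\<V>.
      nonzero_density {j. 1 \<le> j \<and> dyadic_digit w (nth_elem (?hits V) j) = 1}"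
    using nth_elem_in[OF inf]
    by (intro AE_ball_countable[THEN iffD2, OF \<V>(1)] ballI AE_nonzero_density_digits
        inj_on_nth_elem inf) auto
  ultimately show "AE w in restrict_space lborel {0<..1}.
      ?G = ideal_cluster_points X I (subseq_along x w)"
  proof eventually_elim
    case (elim w)
    define S where "S = {i. 1 \<le> i \<and> dyadic_digit w i = 1}"
    have "?G = ideal_cluster_points X I (\<lambda>n. x (nth_elem S n))"
    proof (rule ideal_cluster_points_along_eq[OF assms(1) _ _ \<V>(2,3,4)])
      show "nonzero_density {j. 1 \<le> j \<and> nth_elem (?hits V) j \<in> S}" if "V \<in> \<V>" for V
      proof -
        have "{j. 1 \<le> j \<and> nth_elem (?hits V) j \<in> S}
            = {j. 1 \<le> j \<and> dyadic_digit w (nth_elem (?hits V) j) = 1}"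
          using nth_elem_in[OF inf[OF that]] by (auto simp: S_def)
        then show ?thesis using elim(2) that by simp
      qed
    qed (use elim(1) in \<open>auto simp: S_def\<close>)
    then show ?case by (simp add: subseq_along_def[abs_def] S_def)
  qed
qed

end
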